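(* $\mathrm{Aut}(KO_{1[(3^4,4^2)]})=\langle\alpha_1,\alpha_2,\alpha_3\rangle\cong\mathbb{Z}_2\times\mathbb{Z}_2\times\mathbb{Z}_3$, $\mathrm{Aut}(KO_{2[(3^4,4^2)]})=\langle\beta_1,\beta_2,\beta_3\rangle\cong D_6$ and $\mathrm{Aut}(KNO_{[(3^4,4^2)]})=\langle\gamma_1,\gamma_2\rangle\cong\mathbb{Z}_2\times\mathbb{Z}_2$, where $\alpha_1=(0,3,2)(1,4,5)(6,8,9)(7,10,11)$, $\alpha_2=(0,4)(1,2)(3,5)(6,10)(7,9)(8,11)$, $\alpha_3=(0,9)(1,11)(2,8)(3,6)(4,7)(5,10)$, $\beta_1=(0,2)(1,3)(4,5)(6,10)(7,9)(8,11)$, $\beta_2=(0,4,3)(1,2,5)(6,8,9)(7,10,11)$, $\beta_3=(0,6)(1,11)(2,10)(3,8)(4,9)(5,7)$, $\gamma_1=(0,4)(1,2)(3,5)(6,10)(7,9)(8,11)$ and $\gamma_2=(0,7)(1,8)(2,11)(3,10)(4,9)(5,6)$.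
   Context: A map is a finite (combinatorial) polyhedral 2-complex whose geometric carrier is a compact connected 2-manifold without boundary; its 2-faces are polygons identified with cycles of distinct vertices. An automorphism of a map is a permutation of its vertex set carrying faces (as cycles) onto faces; $\mathrm{Aut}(X)$ is the group of all automorphisms of $X$ under composition. Permutations are written in disjoint cycle notation, omitted vertices being fixed. $D_6$ denotes the dihedral group of order $12$. The following maps have vertex set $\{0,1,\dots,11\}$; $[a,b,c]$ is a triangle and $[a,b,c,d]$ is the quadrilateral with boundary cycle $a\,b\,c\,d\,a$. $KO_{1[(3^4,4^2)]}$ has faces: $[0,1,8,7]$, $[0,5,6,7]$, $[5,6,11,2]$, $[1,8,10,3]$, $[3,10,9,4]$, $[2,11,9,4]$, $[0,4,5]$, $[0,1,2]$, $[0,3,4]$, $[0,2,3]$, $[6,7,9]$, $[7,8,11]$, $[7,9,10]$, $[7,10,11]$, $[2,3,5]$, $[1,3,5]$, $[6,10,11]$, $[6,8,10]$, $[1,4,5]$, $[1,2,4]$, $[6,8,9]$, $[8,9,11]$. $KO_{2[(3^4,4^2)]}$ has faces: $[0,1,8,7]$, $[0,5,6,7]$, $[5,6,11,3]$, $[1,8,10,4]$, $[4,10,9,2]$, $[3,11,9,2]$, $[0,4,5]$, $[0,1,2]$, $[0,3,4]$, $[0,2,3]$, $[6,7,9]$, $[7,8,11]$, $[7,9,10]$, $[7,10,11]$, $[1,3,4]$, $[1,3,5]$, $[6,10,11]$, $[6,8,10]$, $[2,4,5]$, $[1,2,5]$, $[6,8,9]$, $[8,9,11]$. $KNO_{[(3^4,4^2)]}$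 has faces: $[0,1,8,7]$, $[0,5,6,7]$, $[5,6,2,11]$, $[1,8,3,10]$, $[10,3,4,9]$, $[11,2,4,9]$, $[0,4,5]$, $[0,1,2]$, $[0,3,4]$, $[0,2,3]$, $[6,7,9]$, $[7,8,11]$, $[7,9,10]$, $[7,10,11]$, $[2,3,6]$, $[3,6,8]$, $[5,10,11]$, $[1,5,10]$, $[1,4,5]$, $[1,2,4]$, $[6,8,9]$, $[8,9,11]$. *)

theory Defs
  imports "HOL-Algebra.Elementary_Groups" "HOL-Combinatorics.Cycles"
begin

section \<open>Polyhedral complexes and their automorphisms\<close>

text \<open>
  The cycle through the vertices listed in \<open>xs\<close>, without base point or orientation: the set of
  all lists which spell out the same closed polygon.
\<close>

definition polygon :: "'a list \<Rightarrow> 'a list set" where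
  "polygon xs = {rotate n xs | n. True} \<union> {rotate n (rev xs) | n. True}"

lemma image_map_polygon: "map p ` polygon xs = polygon (map p xs)"
  by (auto simp: polygon_def image_iff rotate_map rev_map; metis rotate_map rev_map)

record 'a polyhedral_complex =
  vertices :: "'a set"
  faces :: "'a list set set"

definition sym_group_on :: "'a set \<Rightarrow> ('a \<Rightarrow> 'a) monoid" where
  "sym_group_on V = \<lparr>carrier = {p. p permutes V}, monoid.mult = (\<circ>), one = id\<rparr>"

lemma group_sym_group_on: "group (sym_group_on V)"
proof (rule groupI)
  fix p assume "p \<in> carrier (sym_group_on V)"
  then show "\<exists>q\<in>carrier (sym_group_on V). q \<otimes>\<^bsub>sym_group_on V\<^esub> p = \<one>\<^bsub>sym_group_on V\<^esub>"
    by (auto simp: sym_group_on_def intro!: bexI[of _ "inv_into UNIV p"] permutes_inv permutes_inv_o)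
qed (auto simp: sym_group_on_def permutes_compose permutes_id comp_assoc)

definition is_automorphism :: "'a polyhedral_complex \<Rightarrow> ('a \<Rightarrow> 'a) \<Rightarrow> bool" where
  "is_automorphism X p \<longleftrightarrow> p permutes vertices X \<and> (\<lambda>F. map p ` F) ` faces X = faces X"

definition Aut :: "'a polyhedral_complex \<Rightarrow> ('a \<Rightarrow> 'a) monoid" where
  "Aut X = (sym_group_on (vertices X)) \<lparr>carrier := {p. is_automorphism X p}\<rparr>"

lemma subgroup_automorphisms:
  "subgroup {p. is_automorphism X p} (sym_group_on (vertices X))"
proof -
  let ?S = "sym_group_on (vertices X)"
  interpret group ?S by (rule group_sym_group_on)
  have inv: "inv\<^bsub>?S\<^esub> p = inv_into UNIV p" if "p permutes vertices X" for p
    using that by (intro inv_equality)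
      (auto simp: sym_group_on_def permutes_inv permutes_inv_o)
  have inv_faces: "(\<lambda>F. map (inv_into UNIV p) ` F) ` faces X = faces X"
    if "is_automorphism X p" for p
  proof -
    have "map (inv_into UNIV p) ` map p ` F = F" for F
      using that by (auto simp: is_automorphism_def image_image permutes_inv_o(2))
    then have "(\<lambda>F. map (inv_into UNIV p) ` F) ` (\<lambda>F. map p ` F) ` faces X = faces X"
      by (simp add: image_image)
    then show ?thesis
      using that by (simp add: is_automorphism_def)
  qed
  show ?thesis
  proof
    fix p q assume "p \<in> {p. is_automorphism X p}" "q \<in> {p. is_automorphism X p}"
    moreover from this have
      "(\<lambda>F. map (p \<circ> q) ` F) ` faces X = (\<lambda>F. map p ` F) ` (\<lambda>F. map q ` F) ` faces X"
      by (simp add: image_image o_def)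
    ultimately show "p \<otimes>\<^bsub>?S\<^esub> q \<in> {p. is_automorphism X p}"
      by (simp add: is_automorphism_def sym_group_on_def permutes_compose)
  qed (auto simp: is_automorphism_def sym_group_on_def inv[unfolded sym_group_on_def]
      permutes_inv permutes_id inv_faces[unfolded is_automorphism_def])
qed

section \<open>Dihedral groups\<close>

text \<open>
  The dihedral group of order \<open>2 n\<close> as the semidirect product of \<open>\<int>\<^sub>n\<close> by an inversion:
  \<open>(a, False)\<close> is the \<open>a\<close>-th power of the rotation \<open>r\<close>, and \<open>(a, True)\<close> is this power times
  the reflection \<open>s\<close>, where \<open>s r s = r\<^sup>-\<^sup>1\<close>.
\<close>

definition dihedral_group :: "nat \<Rightarrow> (int \<times> bool) monoid" where
  "dihedral_group n =
    \<lparr>carrier = {0..<int n} \<times> UNIV,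
     monoid.mult = (\<lambda>(a, s) (b, t). ((if s then a - b else a + b) mod int n, s \<noteq> t)),
     one = (0, False)\<rparr>"

lemma group_dihedral_group:
  assumes "n > 0"
  shows "group (dihedral_group n)"
proof (rule groupI)
  fix x assume x: "x \<in> carrier (dihedral_group n)"
  obtain a s where [simp]: "x = (a, s)" by (cases x)
  show "\<exists>y\<in>carrier (dihedral_group n). y \<otimes>\<^bsub>dihedral_group n\<^esub> x = \<one>\<^bsub>dihedral_group n\<^esub>"
    using x assms
    by (intro bexI[of _ "(if s then a else (- a) mod int n, s)"])
      (auto simp: dihedral_group_def mod_simps)
qed (use assms in \<open>auto simp: dihedral_group_def mod_simps algebra_simps\<close>)

lemma order_dihedral_group: "order (dihedral_group n) = 2 * n"
  by (simp add: order_def dihedral_group_def card_cartesian_product)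

section \<open>The three maps\<close>

definition KO1 :: "nat polyhedral_complex" where
  "KO1 = \<lparr>vertices = {0..11}, faces = polygon `
    {[0,1,8,7], [0,5,6,7], [5,6,11,2], [1,8,10,3], [3,10,9,4], [2,11,9,4],
     [0,4,5], [0,1,2], [0,3,4], [0,2,3], [6,7,9], [7,8,11], [7,9,10], [7,10,11],
     [2,3,5], [1,3,5], [6,10,11], [6,8,10], [1,4,5], [1,2,4], [6,8,9], [8,9,11]}\<rparr>"

definition KO2 :: "nat polyhedral_complex" where
  "KO2 = \<lparr>vertices = {0..11}, faces = polygon `
    {[0,1,8,7], [0,5,6,7], [5,6,11,3], [1,8,10,4], [4,10,9,2], [3,11,9,2],
     [0,4,5], [0,1,2], [0,3,4], [0,2,3], [6,7,9], [7,8,11], [7,9,10], [7,10,11],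
     [1,3,4], [1,3,5], [6,10,11], [6,8,10], [2,4,5], [1,2,5], [6,8,9], [8,9,11]}\<rparr>"

definition KNO :: "nat polyhedral_complex" where
  "KNO = \<lparr>vertices = {0..11}, faces = polygon `
    {[0,1,8,7], [0,5,6,7], [5,6,2,11], [1,8,3,10], [10,3,4,9], [11,2,4,9],
     [0,4,5], [0,1,2], [0,3,4], [0,2,3], [6,7,9], [7,8,11], [7,9,10], [7,10,11],
     [2,3,6], [3,6,8], [5,10,11], [1,5,10], [1,4,5], [1,2,4], [6,8,9], [8,9,11]}\<rparr>"

section \<open>The permutations\<close>

definition cycles :: "'a list list \<Rightarrow> 'a \<Rightarrow> 'a" where
  "cycles css = foldr (\<lambda>cs p. cycle_of_list cs \<circ> p) css id"

definition \<alpha>\<^sub>1 :: "nat \<Rightarrow> nat" where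
  "\<alpha>\<^sub>1 = cycles [[0,3,2], [1,4,5], [6,8,9], [7,10,11]]"

definition \<alpha>\<^sub>2 :: "nat \<Rightarrow> nat" where
  "\<alpha>\<^sub>2 = cycles [[0,4], [1,2], [3,5], [6,10], [7,9], [8,11]]"

definition \<alpha>\<^sub>3 :: "nat \<Rightarrow> nat" where
  "\<alpha>\<^sub>3 = cycles [[0,9], [1,11], [2,8], [3,6], [4,7], [5,10]]"

definition \<beta>\<^sub>1 :: "nat \<Rightarrow> nat" where
  "\<beta>\<^sub>1 = cycles [[0,2], [1,3], [4,5], [6,10], [7,9], [8,11]]"

definition \<beta>\<^sub>2 :: "nat \<Rightarrow> nat" where
  "\<beta>\<^sub>2 = cycles [[0,4,3], [1,2,5], [6,8,9], [7,10,11]]"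

definition \<beta>\<^sub>3 :: "nat \<Rightarrow> nat" where
  "\<beta>\<^sub>3 = cycles [[0,6], [1,11], [2,10], [3,8], [4,9], [5,7]]"

definition \<gamma>\<^sub>1 :: "nat \<Rightarrow> nat" where
  "\<gamma>\<^sub>1 = cycles [[0,4], [1,2], [3,5], [6,10], [7,9], [8,11]]"

definition \<gamma>\<^sub>2 :: "nat \<Rightarrow> nat" where
  "\<gamma>\<^sub>2 = cycles [[0,7], [1,8], [2,11], [3,10], [4,9], [5,6]]"

end

theory Submission
  imports Defs
begin

text \<open>
  An automorphism of a map is determined by what it does to one vertex and its star, and here even
  the image of the vertex 0 suffices. All three maps have the same star at 0, with link
  1 8 7 6 5 4 3 2, in which 07 is the edge shared by the two quadrilaterals. So an automorphism
  that fixes 0 fixes 7 and acts on the link either trivially or by the reflection that exchanges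
  1 with 5, 8 with 6, and 2 with 4. The reflection exchanges the triangles 124 and 245, of which
  exactly one is a face, so it is impossible; and if the star of 0 is fixed pointwise, then the star
  of 7, which the maps also share, is fixed too, and every vertex lies in one of the two
  (\<open>vertex_rigid_0I\<close>).

  Consequently an automorphism group acts regularly on the orbit of 0. Relations between given
  automorphisms need to be tested at 0 only (\<open>automorphism_eqI\<close>), and a homomorphism from an
  abstract group into the automorphism group is an isomorphism as soon as the images of 0 under it
  are pairwise distinct and exhaust that orbit (\<open>regular_action\<close>). In \<open>KO1\<close> and
  \<open>KO2\<close> the given automorphisms are transitive on the 12 vertices. In \<open>KNO\<close> they move 0
  only to 0, 4, 7 and 9; no automorphism moves it elsewhere, because a triangle lying at the star of
  0 as 124 does occurs at these four vertices only (\<open>image_0_KNO\<close>).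

  The homomorphisms come from relations: commuting elements of orders 2, 2, 3 and 2, 2 for the
  direct products, and for the dihedral group a rotation \<open>\<beta>\<^sub>1 \<beta>\<^sub>2\<close> of order 6, the product of
  commuting elements of orders 2 and 3, that is inverted by the involution \<open>\<beta>\<^sub>3\<close>.
\<close>


section \<open>Polygons and face-preserving permutations\<close>

text \<open>
  Rotations repeat with the length of the list. This makes a polygon an explicit finite set, so
  that membership of a concrete list can be decided by rewriting.
\<close>

lemma polygon_eq_rotations:
  "polygon xs = (\<lambda>n. rotate n xs) ` {..<length xs} \<union> (\<lambda>n. rotate n (rev xs)) ` {..<length xs}"
  if "xs \<noteq> []"
proof -
  have "{rotate n ys | n. True} = (\<lambda>n. rotate n ys) ` {..<length ys}" if "ys \<noteq> []" for ys :: "'a list"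
  proof -
    have "rotate n ys \<in> (\<lambda>n. rotate n ys) ` {..<length ys}" for n
      using that by (subst rotate_conv_mod) simp
    then show ?thesis by auto
  qed
  from this[of xs] this[of "rev xs"] that show ?thesis by (simp add: polygon_def)
qed

lemma polygon_triangle:
  "polygon [a, b, c] = {[a,b,c], [b,c,a], [c,a,b], [c,b,a], [b,a,c], [a,c,b]}"
  by (simp add: polygon_eq_rotations[of "[a, b, c]"] lessThan_Suc; blast)

lemma polygon_quadrilateral:
  "polygon [a, b, c, d] =
    {[a,b,c,d], [b,c,d,a], [c,d,a,b], [d,a,b,c], [d,c,b,a], [c,b,a,d], [b,a,d,c], [a,d,c,b]}"
  by (simp add: polygon_eq_rotations[of "[a, b, c, d]"] lessThan_Suc; blast)

lemma rotate_inverse: "\<exists>k. rotate k (rotate n xs) = xs"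
proof (cases "xs = []")
  case False
  have "rotate (length xs - n mod length xs) (rotate (n mod length xs) xs) = xs"
    using False by (simp add: rotate_rotate less_imp_le)
  then show ?thesis by (metis rotate_conv_mod)
qed simp

lemma rev_rotate_eq_rotate_rev: "\<exists>k. rev (rotate n xs) = rotate k (rev xs)"
proof (cases "n mod length xs = 0")
  case True
  then have "rev (rotate n xs) = rotate 0 (rev xs)" by simp
  then show ?thesis ..
next
  case False
  have "n mod length xs < length xs" if "xs \<noteq> []" using that by simp
  with False have "rotate (length xs - n mod length xs) (rev xs) = rev (rotate (n mod length xs) xs)"
    by (cases "xs = []") (auto simp: rotate_rev)
  then show ?thesis by (metis rotate_conv_mod)
qed

lemma polygon_rotate: "polygon (rotate n xs) = polygon xs"
proof -
  have rotations: "{rotate k (rotate n ys) | k. True} = {rotate k ys | k. True}"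
    for n and ys :: "'a list"
  proof -
    obtain j where "rotate j (rotate n ys) = ys" using rotate_inverse by blast
    then have "rotate m ys = rotate (m + j) (rotate n ys)" for m
      by (metis rotate_rotate)
    then show ?thesis by (fastforce simp: rotate_rotate)
  qed
  obtain k where "rev (rotate n xs) = rotate k (rev xs)"
    using rev_rotate_eq_rotate_rev by blast
  then show ?thesis by (simp only: polygon_def rotations)
qed

lemma polygon_rev: "polygon (rev xs) = polygon xs"
  by (auto simp: polygon_def)

lemma polygon_eq_iff: "polygon xs = polygon ys \<longleftrightarrow> xs \<in> polygon ys"
proof
  have "rotate 0 xs \<in> polygon xs" unfolding polygon_def by blast
  then show "polygon xs = polygon ys \<Longrightarrow> xs \<in> polygon ys" by simp
next
  assume "xs \<in> polygon ys"
  then obtain n where "xs = rotate n ys \<or> xs = rotate n (rev ys)"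
    by (auto simp: polygon_def)
  then show "polygon xs = polygon ys"
    by (auto simp: polygon_rotate polygon_rev)
qed

text \<open>
  Face membership is a disjunction of equations of this form. This rule and the next match the
  polygon as a whole, so that such an equation becomes a finite list of equations of vertices; expanding each
  polygon separately would leave equations between sets of lists.
\<close>

lemma polygon_eq_triangle:
  "polygon xs = polygon [a, b, c] \<longleftrightarrow> xs \<in> {[a,b,c], [b,c,a], [c,a,b], [c,b,a], [b,a,c], [a,c,b]}"
  by (subst polygon_eq_iff) (simp only: polygon_triangle)

lemma polygon_eq_quadrilateral:
  "polygon xs = polygon [a, b, c, d] \<longleftrightarrow> xs \<in>
    {[a,b,c,d], [b,c,d,a], [c,d,a,b], [d,a,b,c], [d,c,b,a], [c,b,a,d], [b,a,d,c], [a,d,c,b]}"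
  by (subst polygon_eq_iff) (simp only: polygon_quadrilateral)

lemma automorphism_face_iff:
  assumes "is_automorphism X p"
  shows "polygon (map p xs) \<in> faces X \<longleftrightarrow> polygon xs \<in> faces X"
proof -
  have "inj p" and faces: "(\<lambda>F. map p ` F) ` faces X = faces X"
    using assms by (auto simp: is_automorphism_def permutes_inj)
  then have "inj (\<lambda>F. map p ` F)"
    by (simp add: inj_image_eq_iff inj_def)
  then show ?thesis
    by (metis faces image_map_polygon inj_image_mem_iff)
qed

text \<open>
  A permutation is injective on sets of lists, so on finitely many faces it is enough that faces go to
  faces; that every face is hit then follows by counting.
\<close>

lemma is_automorphismI:
  assumes "p permutes vertices X" and fin: "finite (faces X)"
    and faces: "\<forall>F\<in>faces X. map p ` F \<in> faces X"
  shows "is_automorphism X p"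
proof -
  have "inj p" using assms(1) by (rule permutes_inj)
  then have "inj_on (\<lambda>F. map p ` F) (faces X)"
    by (simp add: inj_image_eq_iff inj_on_def)
  then have "(\<lambda>F. map p ` F) ` faces X = faces X"
    using fin faces by (intro endo_inj_surj) blast+
  then show ?thesis
    using assms(1) by (simp add: is_automorphism_def)
qed

lemma cycles_permutes: "\<forall>cs\<in>set css. set cs \<subseteq> V \<Longrightarrow> cycles css permutes V"
proof (induction css)
  case (Cons cs css)
  have "cycle_of_list cs permutes V"
    using Cons.prems by (auto intro: permutes_subset[OF cycle_permutes])
  moreover have "cycles css permutes V" using Cons by simp
  moreover have "cycles (cs # css) = cycle_of_list cs \<circ> cycles css" by (simp add: cycles_def)
  ultimately show ?case by (simp only: permutes_compose)
qed (simp add: cycles_def)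


section \<open>Automorphism groups\<close>

lemma carrier_Aut: "carrier (Aut X) = {p. is_automorphism X p}"
  and mult_Aut: "p \<otimes>\<^bsub>Aut X\<^esub> q = p \<circ> q"
  and one_Aut: "\<one>\<^bsub>Aut X\<^esub> = id"
  by (simp_all add: Aut_def sym_group_on_def)

lemma group_Aut: "group (Aut X)"
  unfolding Aut_def
  by (rule subgroup.subgroup_is_group[OF subgroup_automorphisms group_sym_group_on])

lemma pow_Aut: "p [^]\<^bsub>Aut X\<^esub> (n::nat) = p ^^ n"
  by (induction n) (simp_all add: one_Aut mult_Aut nat_pow_def funpow_Suc_right del: funpow.simps(2))

lemma int_pow_Aut: "0 \<le> k \<Longrightarrow> p [^]\<^bsub>Aut X\<^esub> (k::int) = p ^^ nat k"
  by (metis int_pow_int nat_0_le pow_Aut)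

lemma generate_sym_compose:
  "p \<in> generate (sym_group_on V) S \<Longrightarrow> q \<in> generate (sym_group_on V) S
    \<Longrightarrow> p \<circ> q \<in> generate (sym_group_on V) S"
  using generate.eng[of p "sym_group_on V" S q] by (simp add: sym_group_on_def)

lemma generate_sym_id: "id \<in> generate (sym_group_on V) S"
  using generate.one[of "sym_group_on V" S] unfolding sym_group_on_def by simp

lemma generate_sym_funpow:
  "p \<in> generate (sym_group_on V) S \<Longrightarrow> p ^^ n \<in> generate (sym_group_on V) S"
proof (induction n)
  case 0
  show ?case by (simp only: funpow.simps(1) generate_sym_id)
qed (simp add: generate_sym_compose)

lemma carrier_Aut_eq_generate:
  assumes "S \<subseteq> carrier (Aut X)" and "carrier (Aut X) \<subseteq> generate (sym_group_on (vertices X)) S"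
  shows "carrier (Aut X) = generate (sym_group_on (vertices X)) S"
proof
  show "generate (sym_group_on (vertices X)) S \<subseteq> carrier (Aut X)"
    using assms(1) unfolding carrier_Aut
    by (rule group.generate_subgroup_incl[OF group_sym_group_on _ subgroup_automorphisms])
qed (rule assms(2))

text \<open>
  A trivial vertex stabilizer turns equations between automorphisms into equations between
  vertices.
\<close>

locale vertex_rigid =
  fixes X :: "'a polyhedral_complex" and v :: 'a
  assumes fixes_imp_id: "\<lbrakk>is_automorphism X p; p v = v\<rbrakk> \<Longrightarrow> p = id"
begin

sublocale group "Aut X" by (rule group_Aut)

lemma automorphism_eqI:
  assumes "p \<in> carrier (Aut X)" "q \<in> carrier (Aut X)" "p v = q v"
  shows "p = q"
proof -
  let ?r = "inv\<^bsub>Aut X\<^esub> q \<otimes>\<^bsub>Aut X\<^esub> p"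
  have "inv\<^bsub>Aut X\<^esub> q \<circ> q = id"
    using l_inv[OF assms(2)] by (simp add: mult_Aut one_Aut)
  then have "?r v = v"
    using assms(3) by (simp add: mult_Aut fun_eq_iff)
  moreover have "is_automorphism X ?r"
    using assms by (simp flip: mem_Collect_eq[of _ "is_automorphism X"] add: carrier_Aut[symmetric])
  ultimately have "?r = \<one>\<^bsub>Aut X\<^esub>" by (simp add: fixes_imp_id one_Aut)
  then show "p = q" using assms
    by (metis inv_closed inv_equality inv_inv)
qed

text \<open>
  The elements \<open>\<phi> a\<close> already move \<open>v\<close> to every vertex that any automorphism can move it to,
  and an automorphism is known from its value at \<open>v\<close>; so \<open>\<phi>\<close> is onto. It is injective because
  distinct \<open>a\<close> move \<open>v\<close> to distinct places, by the count of the orbit.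
\<close>

lemma regular_action:
  assumes hom: "\<phi> \<in> hom A (Aut X)" and "group A" and "finite (carrier A)"
    and image: "(\<lambda>a. \<phi> a v) ` carrier A = B" and card: "card B = card (carrier A)"
    and orbit: "\<And>p. is_automorphism X p \<Longrightarrow> p v \<in> B"
    and gens: "S \<subseteq> carrier (Aut X)"
    and gen: "\<And>a. a \<in> carrier A \<Longrightarrow> \<phi> a \<in> generate (sym_group_on (vertices X)) S"
  shows "carrier (Aut X) = generate (sym_group_on (vertices X)) S \<and> Aut X \<cong> A"
proof -
  have "inj_on (\<lambda>a. \<phi> a v) (carrier A)"
    by (rule eq_card_imp_inj_on[OF \<open>finite (carrier A)\<close>]) (simp only: image card)
  then have inj: "inj_on \<phi> (carrier A)" by (auto simp: inj_on_def)
  have "p \<in> \<phi> ` carrier A" if p: "p \<in> carrier (Aut X)" for p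
  proof -
    obtain a where a: "a \<in> carrier A" "p v = \<phi> a v"
      using orbit[of p] p unfolding carrier_Aut image[symmetric] by blast
    then have "p = \<phi> a" using automorphism_eqI p hom_in_carrier[OF hom] by blast
    then show ?thesis using a by simp
  qed
  then have surj: "\<phi> ` carrier A = carrier (Aut X)"
    using hom_in_carrier[OF hom] by blast
  then have "\<phi> \<in> iso A (Aut X)"
    using hom inj by (simp add: iso_def bij_betw_def)
  then have "Aut X \<cong> A"
    by (intro group.iso_sym[OF \<open>group A\<close>] is_isoI)
  moreover have "carrier (Aut X) = generate (sym_group_on (vertices X)) S"
    using gens by (rule carrier_Aut_eq_generate) (use gen in \<open>unfold surj[symmetric], blast\<close>)
  ultimately show ?thesis by simp
qed

end


section \<open>Homomorphisms given by relations\<close>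

lemma (in group) int_pow_cong_mod:
  assumes "x \<in> carrier G" "x [^] n = \<one>"
  shows "x [^] (k mod int n) = x [^] k"
proof -
  have "x [^] k = x [^] (int n * (k div int n) + k mod int n)" by simp
  also have "\<dots> = x [^] (int n * (k div int n)) \<otimes> x [^] (k mod int n)"
    using assms by (simp only: int_pow_mult)
  also have "x [^] (int n * (k div int n)) = \<one>"
    using assms by (simp add: int_pow_pow[symmetric] int_pow_int)
  finally show ?thesis using assms by simp
qed

lemma (in group) hom_integer_mod_group:
  assumes "x \<in> carrier G" "x [^] n = \<one>"
  shows "(\<lambda>k. x [^] k) \<in> hom (integer_mod_group n) G"
  using assms by (auto simp: hom_def int_pow_cong_mod int_pow_mult)

lemma (in group) hom_DirProd_commuting:
  assumes f: "f \<in> hom H G" and g: "g \<in> hom K G"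
    and comm: "\<And>x y. \<lbrakk>x \<in> carrier H; y \<in> carrier K\<rbrakk> \<Longrightarrow> f x \<otimes> g y = g y \<otimes> f x"
  shows "(\<lambda>(x, y). f x \<otimes> g y) \<in> hom (H \<times>\<times> K) G"
proof (rule homI; clarsimp)
  fix x y x' y' assume *: "x \<in> carrier H" "y \<in> carrier K" "x' \<in> carrier H" "y' \<in> carrier K"
  show "f (x \<otimes>\<^bsub>H\<^esub> x') \<otimes> g (y \<otimes>\<^bsub>K\<^esub> y') = f x \<otimes> g y \<otimes> (f x' \<otimes> g y')"
  proof -
    have [simp]: "f x \<in> carrier G" "f x' \<in> carrier G" "g y \<in> carrier G" "g y' \<in> carrier G"
      using * hom_in_carrier[OF f] hom_in_carrier[OF g] by auto
    have "f (x \<otimes>\<^bsub>H\<^esub> x') \<otimes> g (y \<otimes>\<^bsub>K\<^esub> y') = f x \<otimes> (f x' \<otimes> g y) \<otimes> g y'"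
      using * by (simp add: hom_mult[OF f] hom_mult[OF g] m_assoc)
    also have "f x' \<otimes> g y = g y \<otimes> f x'" using * by (simp add: comm)
    finally show ?thesis by (simp add: m_assoc)
  qed
qed (use hom_in_carrier[OF f] hom_in_carrier[OF g] in auto)

lemma (in group) int_pow_commute:
  assumes comm: "x \<otimes> y = y \<otimes> x" and xy: "x \<in> carrier G" "y \<in> carrier G"
  shows "x [^] (a::int) \<otimes> y [^] (b::int) = y [^] b \<otimes> x [^] a"
proof -
  have swap: "z [^] k \<otimes> w = w \<otimes> z [^] k"
    if "z \<otimes> w = w \<otimes> z" and zw: "z \<in> carrier G" "w \<in> carrier G" for z w and k :: int
  proof (cases k)
    case (nonneg n)
    then show ?thesis using that by (simp add: int_pow_int group_commutes_pow)
  next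
    case (neg n)
    define u where "u = z [^] Suc n"
    have u: "u \<in> carrier G" "z [^] k = inv u" "u \<otimes> w = w \<otimes> u"
      using that by (simp_all only: u_def neg int_pow_neg int_pow_int nat_pow_closed group_commutes_pow)
    have "inv u \<otimes> w = inv u \<otimes> (w \<otimes> u) \<otimes> inv u"
      using u(1) zw by (simp add: m_assoc)
    also have "\<dots> = w \<otimes> inv u"
      using u(1) zw by (simp add: u(3)[symmetric] m_assoc[symmetric])
    finally show ?thesis by (simp only: u(2))
  qed
  have "y [^] b \<otimes> x = x \<otimes> y [^] b"
    using comm xy by (intro swap) simp_all
  then show ?thesis
    using xy by (intro swap) simp_all
qed

lemma (in group) commute_mult:
  assumes "x \<otimes> y = y \<otimes> x" "x \<otimes> z = z \<otimes> x"
    and xyz: "x \<in> carrier G" "y \<in> carrier G" "z \<in> carrier G"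
  shows "x \<otimes> (y \<otimes> z) = y \<otimes> z \<otimes> x"
proof -
  have "x \<otimes> (y \<otimes> z) = y \<otimes> x \<otimes> z"
    using xyz by (simp flip: assms(1) add: m_assoc)
  also have "\<dots> = y \<otimes> z \<otimes> x"
    using xyz by (simp add: assms(2) m_assoc)
  finally show ?thesis .
qed

text \<open>
  The relations of the usual presentation of the dihedral group: a rotation \<open>x\<close> whose order divides
  \<open>n\<close>, and elements \<open>y\<close> and \<open>y x\<close> with square 1. The last relation says that conjugation
  by \<open>y\<close> inverts \<open>x\<close>, hence all powers of \<open>x\<close>, and this is the twist in the
  multiplication of the semidirect product.
\<close>

lemma (in group) hom_dihedral_group:
  assumes x: "x \<in> carrier G" "x [^] n = \<one>" and y: "y \<in> carrier G" "y \<otimes> y = \<one>"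
    and yx: "(y \<otimes> x) \<otimes> (y \<otimes> x) = \<one>"
  shows "(\<lambda>(a, s). x [^] a \<otimes> (if s then y else \<one>)) \<in> hom (dihedral_group n) G"
proof -
  interpret conj: group_hom G G "\<lambda>z. y \<otimes> z \<otimes> y"
  proof
    show "(\<lambda>z. y \<otimes> z \<otimes> y) \<in> hom G G"
    proof (rule homI)
      fix z w assume zw: "z \<in> carrier G" "w \<in> carrier G"
      have "y \<otimes> z \<otimes> y \<otimes> (y \<otimes> w \<otimes> y) = y \<otimes> z \<otimes> (y \<otimes> y) \<otimes> w \<otimes> y"
        using y(1) zw by (simp only: m_assoc m_closed)
      then show "y \<otimes> (z \<otimes> w) \<otimes> y = y \<otimes> z \<otimes> y \<otimes> (y \<otimes> w \<otimes> y)"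
        using y zw by (simp add: m_assoc)
    qed (use y in simp)
  qed
  have "y \<otimes> x \<otimes> y = inv x"
    using x y yx by (intro inv_equality[symmetric]) (simp_all add: m_assoc)
  then have conj_pow: "y \<otimes> x [^] k \<otimes> y = x [^] (- k)" for k :: int
    using conj.hom_int_pow[of x k] x by (simp add: int_pow_neg int_pow_inv)
  have swap: "y \<otimes> x [^] k = x [^] (- k) \<otimes> y" for k :: int
  proof -
    have "y \<otimes> x [^] k = y \<otimes> x [^] k \<otimes> (y \<otimes> y)" using x y by simp
    also have "\<dots> = y \<otimes> x [^] k \<otimes> y \<otimes> y" using x y(1) by (simp only: m_assoc m_closed int_pow_closed)
    finally show ?thesis by (simp only: conj_pow)
  qed
  have reflect: "x [^] a \<otimes> y \<otimes> (x [^] b \<otimes> z) = x [^] (a - b) \<otimes> (y \<otimes> z)"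
    if "z \<in> carrier G" for a b :: int and z
  proof -
    have "x [^] a \<otimes> y \<otimes> (x [^] b \<otimes> z) = x [^] a \<otimes> (y \<otimes> x [^] b) \<otimes> z"
      using x y(1) that by (simp only: m_assoc m_closed int_pow_closed)
    also have "\<dots> = x [^] a \<otimes> x [^] (- b) \<otimes> (y \<otimes> z)"
      using x y(1) that by (simp only: swap m_assoc m_closed int_pow_closed)
    also have "x [^] a \<otimes> x [^] (- b) = x [^] (a - b)"
      using x by (simp flip: int_pow_mult)
    finally show ?thesis .
  qed
  have rotate: "x [^] a \<otimes> (x [^] b \<otimes> z) = x [^] (a + b) \<otimes> z"
    if "z \<in> carrier G" for a b :: int and z
    using x that by (simp add: int_pow_mult m_assoc)
  show ?thesis
  proof (rule homI)
    fix u w :: "int \<times> bool"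
    obtain a s b t where [simp]: "u = (a, s)" "w = (b, t)" by fastforce
    show "(case u \<otimes>\<^bsub>dihedral_group n\<^esub> w of (a, s) \<Rightarrow> x [^] a \<otimes> (if s then y else \<one>)) =
      (case u of (a, s) \<Rightarrow> x [^] a \<otimes> (if s then y else \<one>)) \<otimes>
      (case w of (a, s) \<Rightarrow> x [^] a \<otimes> (if s then y else \<one>))"
      using x y reflect[of y a b] reflect[of \<one> a b] rotate[of y a b] rotate[of \<one> a b]
      by (auto simp: dihedral_group_def int_pow_cong_mod)
  qed (use x y in auto)
qed


section \<open>The star of a vertex determines an automorphism\<close>

lemma vertices_12: "{0..11} = {0,1,2,3,4,5,6,7,8,9,10,11::nat}"
  by (simp only: atLeast0AtMost) (simp add: atMost_Suc numeral_eq_Suc; blast)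

text \<open>
  The link of 0 is 1 8 7 6 5 4 3 2, and the part of the link of 7 outside the quadrilaterals is
  6 9 10 11 8. The premise \<open>chord\<close> breaks the only nontrivial symmetry of the star of 0 that
  preserves lengths of faces: this reflection exchanges the triangles 124 and 542, of which exactly
  one is a face.
\<close>

lemma vertex_rigid_0I:
  fixes X :: "nat polyhedral_complex"
  assumes V: "vertices X = {0..11}"
    and quads_0: "\<And>a b c. polygon [0, a, b, c] \<in> faces X \<longleftrightarrow>
      (a, b, c) \<in> {(1,8,7), (7,8,1), (5,6,7), (7,6,5)}"
    and triangles_0: "\<And>a b. polygon [0, a, b] \<in> faces X \<longleftrightarrow>
      (a, b) \<in> {(1,2), (2,1), (2,3), (3,2), (3,4), (4,3), (4,5), (5,4)}"
    and triangles_7: "\<And>a b. polygon [7, a, b] \<in> faces X \<longleftrightarrow>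
      (a, b) \<in> {(6,9), (9,6), (9,10), (10,9), (10,11), (11,10), (11,8), (8,11)}"
    and chord: "(polygon [1, 2, 4] \<in> faces X) \<noteq> (polygon [5, 4, 2] \<in> faces X)"
  shows "vertex_rigid X 0"
proof (unfold_locales)
  fix p assume p: "is_automorphism X p" and p0: "p 0 = 0"
  note face = automorphism_face_iff[OF p]
  have perm: "p permutes {0..11}" using p V by (simp add: is_automorphism_def)
  have neq: "p a \<noteq> p b" if "a \<noteq> b" for a b
    using that permutes_inj[OF perm] by (simp add: inj_eq)
  have q1: "(p 1, p 8, p 7) \<in> {(1,8,7), (7,8,1), (5,6,7), (7,6,5)}"
    using face[of "[0, 1, 8, 7]"] p0 quads_0 by simp
  have q2: "(p 5, p 6, p 7) \<in> {(1,8,7), (7,8,1), (5,6,7), (7,6,5)}"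
    using face[of "[0, 5, 6, 7]"] p0 quads_0 by simp
  have t1: "(p 1, p 2) \<in> {(1,2), (2,1), (2,3), (3,2), (3,4), (4,3), (4,5), (5,4)}"
    using face[of "[0, 1, 2]"] p0 triangles_0 by simp
  have t5: "(p 5, p 4) \<in> {(1,2), (2,1), (2,3), (3,2), (3,4), (4,3), (4,5), (5,4)}"
    using face[of "[0, 5, 4]"] p0 triangles_0 by simp
  have c: "polygon [p 1, p 2, p 4] \<in> faces X \<longleftrightarrow> polygon [1, 2, 4] \<in> faces X"
    using face[of "[1, 2, 4]"] by simp
  have star: "p 7 = 7 \<and> p 1 = 1 \<and> p 8 = 8 \<and> p 5 = 5 \<and> p 6 = 6 \<and> p 2 = 2 \<and> p 4 = 4"
  proof -
    have "p 1 \<noteq> p 5" by (simp add: neq)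
    \<comment> \<open>The two quadrilaterals at 0 stay in place or change places; 7 is on both of them.\<close>
    with q1 q2 consider
        "p 1 = 1" "p 8 = 8" "p 7 = 7" "p 5 = 5" "p 6 = 6"
      | "p 1 = 5" "p 8 = 6" "p 7 = 7" "p 5 = 1" "p 6 = 8"
      by (elim insertE emptyE; simp)
    then show ?thesis
    proof cases
      case 1
      with t1 t5 show ?thesis by simp
    next
      case 2
      with t1 t5 have "p 2 = 4" "p 4 = 2" by simp_all
      with 2 c chord show ?thesis by simp
    qed
  qed
  have t3: "(p 4, p 3) \<in> {(1,2), (2,1), (2,3), (3,2), (3,4), (4,3), (4,5), (5,4)}"
    using face[of "[0, 4, 3]"] p0 triangles_0 by simp
  have p3: "p 3 = 3"
    using t3 star neq[of 3 5] by simp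
  have t9: "(p 6, p 9) \<in> {(6,9), (9,6), (9,10), (10,9), (10,11), (11,10), (11,8), (8,11)}"
    using face[of "[7, 6, 9]"] star triangles_7 by simp
  have t11: "(p 8, p 11) \<in> {(6,9), (9,6), (9,10), (10,9), (10,11), (11,10), (11,8), (8,11)}"
    using face[of "[7, 8, 11]"] star triangles_7 by simp
  have t10: "(p 9, p 10) \<in> {(6,9), (9,6), (9,10), (10,9), (10,11), (11,10), (11,8), (8,11)}"
    using face[of "[7, 9, 10]"] star triangles_7 by simp
  have rest: "p 9 = 9" "p 10 = 10" "p 11 = 11"
    using t9 t10 t11 star neq[of 6 10] by simp_all
  have "p x = x" for x
  proof (cases "x \<in> {0..11}")
    case True
    then show ?thesis
      unfolding vertices_12 using p0 star p3 rest by (elim insertE emptyE) simp_all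
  next
    case False
    then show ?thesis using permutes_not_in[OF perm] by simp
  qed
  then show "p = id" by auto
qed


section \<open>The stars of the three maps and the given automorphisms\<close>

lemmas face_simps = polygon_eq_triangle polygon_eq_quadrilateral
lemmas perm_simps = cycles_def transpose_def

lemma funpow_numeral: "(f ^^ numeral k) x = f ((f ^^ pred_numeral k) x)"
  by (simp add: numeral_eq_Suc)

lemma vertices: "vertices KO1 = {0..11}" "vertices KO2 = {0..11}" "vertices KNO = {0..11}"
  by (simp_all add: KO1_def KO2_def KNO_def)

lemma star_of_0_and_7:
  assumes "X \<in> {KO1, KO2, KNO}"
  shows "polygon [0, a, b, c] \<in> faces X \<longleftrightarrow>
      (a, b, c) \<in> {(1,8,7), (7,8,1), (5,6,7), (7,6,5)}"
    and "polygon [0, a, b] \<in> faces X \<longleftrightarrow>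
      (a, b) \<in> {(1,2), (2,1), (2,3), (3,2), (3,4), (4,3), (4,5), (5,4)}"
    and "polygon [7, a, b] \<in> faces X \<longleftrightarrow>
      (a, b) \<in> {(6,9), (9,6), (9,10), (10,9), (10,11), (11,10), (11,8), (8,11)}"
    and "(polygon [1, 2, 4] \<in> faces X) \<noteq> (polygon [5, 4, 2] \<in> faces X)"
  using assms by (elim insertE emptyE; simp add: KO1_def KO2_def KNO_def face_simps; argo)+

lemma vertex_rigid_0:
  assumes "X \<in> {KO1, KO2, KNO}"
  shows "vertex_rigid X 0"
proof (rule vertex_rigid_0I)
  show "vertices X = {0..11}" using assms vertices by auto
qed (fact star_of_0_and_7[OF assms])+

lemma automorphisms_KO1: "{\<alpha>\<^sub>1, \<alpha>\<^sub>2, \<alpha>\<^sub>3} \<subseteq> carrier (Aut KO1)"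
proof -
  have "is_automorphism KO1 \<alpha>\<^sub>1"
  proof (rule is_automorphismI)
    show "\<alpha>\<^sub>1 permutes vertices KO1"
      unfolding \<alpha>\<^sub>1_def by (rule cycles_permutes) (simp add: KO1_def)
  qed (simp_all add: KO1_def face_simps image_map_polygon \<alpha>\<^sub>1_def perm_simps)
  moreover
  have "is_automorphism KO1 \<alpha>\<^sub>2"
  proof (rule is_automorphismI)
    show "\<alpha>\<^sub>2 permutes vertices KO1"
      unfolding \<alpha>\<^sub>2_def by (rule cycles_permutes) (simp add: KO1_def)
  qed (simp_all add: KO1_def face_simps image_map_polygon \<alpha>\<^sub>2_def perm_simps)
  moreover
  have "is_automorphism KO1 \<alpha>\<^sub>3"
  proof (rule is_automorphismI)
    show "\<alpha>\<^sub>3 permutes vertices KO1"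
      unfolding \<alpha>\<^sub>3_def by (rule cycles_permutes) (simp add: KO1_def)
  qed (simp_all add: KO1_def face_simps image_map_polygon \<alpha>\<^sub>3_def perm_simps)
  ultimately show ?thesis by (simp add: carrier_Aut)
qed

lemma automorphisms_KO2: "{\<beta>\<^sub>1, \<beta>\<^sub>2, \<beta>\<^sub>3} \<subseteq> carrier (Aut KO2)"
proof -
  have "is_automorphism KO2 \<beta>\<^sub>1"
  proof (rule is_automorphismI)
    show "\<beta>\<^sub>1 permutes vertices KO2"
      unfolding \<beta>\<^sub>1_def by (rule cycles_permutes) (simp add: KO2_def)
  qed (simp_all add: KO2_def face_simps image_map_polygon \<beta>\<^sub>1_def perm_simps)
  moreover
  have "is_automorphism KO2 \<beta>\<^sub>2"
  proof (rule is_automorphismI)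
    show "\<beta>\<^sub>2 permutes vertices KO2"
      unfolding \<beta>\<^sub>2_def by (rule cycles_permutes) (simp add: KO2_def)
  qed (simp_all add: KO2_def face_simps image_map_polygon \<beta>\<^sub>2_def perm_simps)
  moreover
  have "is_automorphism KO2 \<beta>\<^sub>3"
  proof (rule is_automorphismI)
    show "\<beta>\<^sub>3 permutes vertices KO2"
      unfolding \<beta>\<^sub>3_def by (rule cycles_permutes) (simp add: KO2_def)
  qed (simp_all add: KO2_def face_simps image_map_polygon \<beta>\<^sub>3_def perm_simps)
  ultimately show ?thesis by (simp add: carrier_Aut)
qed

lemma automorphisms_KNO: "{\<gamma>\<^sub>1, \<gamma>\<^sub>2} \<subseteq> carrier (Aut KNO)"
proof -
  have "is_automorphism KNO \<gamma>\<^sub>1"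
  proof (rule is_automorphismI)
    show "\<gamma>\<^sub>1 permutes vertices KNO"
      unfolding \<gamma>\<^sub>1_def by (rule cycles_permutes) (simp add: KNO_def)
  qed (simp_all add: KNO_def face_simps image_map_polygon \<gamma>\<^sub>1_def perm_simps)
  moreover
  have "is_automorphism KNO \<gamma>\<^sub>2"
  proof (rule is_automorphismI)
    show "\<gamma>\<^sub>2 permutes vertices KNO"
      unfolding \<gamma>\<^sub>2_def by (rule cycles_permutes) (simp add: KNO_def)
  qed (simp_all add: KNO_def face_simps image_map_polygon \<gamma>\<^sub>2_def perm_simps)
  ultimately show ?thesis by (simp add: carrier_Aut)
qed

text \<open>
  The configuration of 0 in \<open>KNO\<close>, with \<open>x\<close>, \<open>y\<close>, \<open>m\<close>, \<open>s\<close>, \<open>t\<close> being 1, 5, 7, 2, 4: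
  two quadrilaterals at \<open>v\<close> share the edge \<open>v m\<close>, their other edges at \<open>v\<close> lead to \<open>x\<close> and \<open>y\<close>,
  the triangles on these edges have third vertices \<open>s\<close> and \<open>t\<close>, and \<open>x s t\<close> is a face. It
  singles out the orbit of 0.
\<close>

lemma KNO_orbit_of_chord:
  assumes v: "v \<in> {0..11}"
    and q: "polygon [v, x, u, m] \<in> faces KNO" "polygon [v, y, w, m] \<in> faces KNO" "x \<noteq> y"
    and t: "polygon [v, x, s] \<in> faces KNO" "polygon [v, y, t] \<in> faces KNO"
    and chord: "polygon [x, s, t] \<in> faces KNO"
  shows "v \<in> {0,4,7,9}"
proof (rule ccontr)
  assume "v \<notin> {0,4,7,9}"
  with v have "v \<in> {1,2,3,5,6,8,10,11}" unfolding vertices_12 by blast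
  \<comment> \<open>At each other vertex \<open>v\<close> the quadrilaterals determine \<open>x\<close> and \<open>y\<close> up to order; the triangles
    then determine \<open>s\<close> and \<open>t\<close>. Fixing \<open>x\<close> and \<open>y\<close> first keeps the number of cases small.\<close>
  then have "(v, x, y) \<in> {(1,0,10), (1,10,0), (2,4,6), (2,6,4),
      (3,4,8), (3,8,4), (5,11,0), (5,0,11),
      (6,7,2), (6,2,7), (8,3,7), (8,7,3),
      (10,1,9), (10,9,1), (11,5,9), (11,9,5)}"
    using q
    by (elim insertE emptyE; hypsubst)
      (simp_all add: KNO_def face_simps, (elim disjE conjE; simp)+)
  then have "polygon [x, s, t] \<notin> faces KNO"
    using t
    by (elim insertE emptyE Pair_inject; hypsubst) (simp_all add: KNO_def face_simps)
  then show False using chord by blast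
qed

lemma image_0_KNO:
  assumes p: "is_automorphism KNO p"
  shows "p 0 \<in> {0, 4, 7, 9}"
proof (rule KNO_orbit_of_chord)
  note face = automorphism_face_iff[OF p]
  have "p permutes {0..11}" using p by (simp add: is_automorphism_def vertices)
  then show "p 0 \<in> {0..11}" "p 1 \<noteq> p 5"
    using permutes_in_image[of p "{0..11}" 0] permutes_inj[of p "{0..11}"] by (simp_all add: inj_eq)
  show "polygon [p 0, p 1, p 8, p 7] \<in> faces KNO"
    using face[of "[0, 1, 8, 7]"] by (simp add: KNO_def)
  show "polygon [p 0, p 5, p 6, p 7] \<in> faces KNO"
    using face[of "[0, 5, 6, 7]"] by (simp add: KNO_def)
  show "polygon [p 0, p 1, p 2] \<in> faces KNO"
    using face[of "[0, 1, 2]"] by (simp add: KNO_def)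
  show "polygon [p 0, p 5, p 4] \<in> faces KNO"
    using face[of "[0, 5, 4]"] by (simp add: KNO_def face_simps)
  show "polygon [p 1, p 2, p 4] \<in> faces KNO"
    using face[of "[1, 2, 4]"] by (simp add: KNO_def)
qed


section \<open>The three automorphism groups\<close>

lemma carrier_Z2: "carrier (integer_mod_group 2) = {0, 1}"
  and carrier_Z3: "carrier (integer_mod_group 3) = {0, 1, 2}"
  by (simp_all add: carrier_integer_mod_group set_eq_iff; presburger)+

lemma carrier_D6: "carrier (dihedral_group 6) = {0, 1, 2, 3, 4, 5} \<times> {False, True}"
proof -
  have "{0..<6} = {0, 1, 2, 3, 4, 5 :: int}" by (simp add: set_eq_iff; presburger)
  then show ?thesis by (simp add: dihedral_group_def UNIV_bool)
qed

lemma automorphism_in_vertices: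
  "is_automorphism X p \<Longrightarrow> v \<in> vertices X \<Longrightarrow> p v \<in> vertices X"
  by (simp add: is_automorphism_def permutes_in_image)

lemma Aut_KO1:
  "carrier (Aut KO1) = generate (sym_group_on {0..11}) {\<alpha>\<^sub>1, \<alpha>\<^sub>2, \<alpha>\<^sub>3} \<and>
    Aut KO1 \<cong> integer_mod_group 2 \<times>\<times> integer_mod_group 2 \<times>\<times> integer_mod_group 3"
proof -
  interpret vertex_rigid KO1 0 by (rule vertex_rigid_0) simp
  let ?G = "Aut KO1"
  note at_0 = pow_Aut int_pow_Aut mult_Aut one_Aut funpow_numeral \<alpha>\<^sub>1_def \<alpha>\<^sub>2_def \<alpha>\<^sub>3_def perm_simps
  have \<alpha>: "\<alpha>\<^sub>1 \<in> carrier ?G" "\<alpha>\<^sub>2 \<in> carrier ?G" "\<alpha>\<^sub>3 \<in> carrier ?G"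
    using automorphisms_KO1 by auto
  note closed = m_closed nat_pow_closed one_closed \<alpha>
  have "\<alpha>\<^sub>2 [^]\<^bsub>?G\<^esub> (2::nat) = \<one>\<^bsub>?G\<^esub>" "\<alpha>\<^sub>3 [^]\<^bsub>?G\<^esub> (2::nat) = \<one>\<^bsub>?G\<^esub>"
    "\<alpha>\<^sub>1 [^]\<^bsub>?G\<^esub> (3::nat) = \<one>\<^bsub>?G\<^esub>"
    by (rule automorphism_eqI, (intro closed)+, simp add: at_0)+
  note powers = this[THEN hom_integer_mod_group[rotated]]
  have comm: "\<alpha>\<^sub>2 \<otimes>\<^bsub>?G\<^esub> \<alpha>\<^sub>3 = \<alpha>\<^sub>3 \<otimes>\<^bsub>?G\<^esub> \<alpha>\<^sub>2" "\<alpha>\<^sub>2 \<otimes>\<^bsub>?G\<^esub> \<alpha>\<^sub>1 = \<alpha>\<^sub>1 \<otimes>\<^bsub>?G\<^esub> \<alpha>\<^sub>2"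
    "\<alpha>\<^sub>3 \<otimes>\<^bsub>?G\<^esub> \<alpha>\<^sub>1 = \<alpha>\<^sub>1 \<otimes>\<^bsub>?G\<^esub> \<alpha>\<^sub>3"
    by (rule automorphism_eqI, (intro closed)+, simp add: at_0)+
  note comm_pow = comm[THEN int_pow_commute]
  let ?\<psi> = "\<lambda>(b :: int, c :: int). \<alpha>\<^sub>3 [^]\<^bsub>?G\<^esub> b \<otimes>\<^bsub>?G\<^esub> \<alpha>\<^sub>1 [^]\<^bsub>?G\<^esub> c"
  let ?\<phi> = "\<lambda>(a :: int, bc). \<alpha>\<^sub>2 [^]\<^bsub>?G\<^esub> a \<otimes>\<^bsub>?G\<^esub> ?\<psi> bc"
  have "?\<psi> \<in> hom (integer_mod_group 2 \<times>\<times> integer_mod_group 3) ?G"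
    by (intro hom_DirProd_commuting powers comm_pow \<alpha>)
  then have hom: "?\<phi> \<in> hom (integer_mod_group 2 \<times>\<times> integer_mod_group 2 \<times>\<times> integer_mod_group 3) ?G"
  proof (rule hom_DirProd_commuting[OF powers(1)[OF \<alpha>(2)]], clarify)
    fix a b c :: int
    show "\<alpha>\<^sub>2 [^]\<^bsub>?G\<^esub> a \<otimes>\<^bsub>?G\<^esub> (\<alpha>\<^sub>3 [^]\<^bsub>?G\<^esub> b \<otimes>\<^bsub>?G\<^esub> \<alpha>\<^sub>1 [^]\<^bsub>?G\<^esub> c) =
      \<alpha>\<^sub>3 [^]\<^bsub>?G\<^esub> b \<otimes>\<^bsub>?G\<^esub> \<alpha>\<^sub>1 [^]\<^bsub>?G\<^esub> c \<otimes>\<^bsub>?G\<^esub> \<alpha>\<^sub>2 [^]\<^bsub>?G\<^esub> a"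
      using \<alpha> by (intro commute_mult comm_pow int_pow_closed)
  qed
  show ?thesis
    unfolding vertices(1)[symmetric]
  proof (rule regular_action[OF hom])
    show "(\<lambda>x. ?\<phi> x 0) ` carrier (integer_mod_group 2 \<times>\<times> integer_mod_group 2 \<times>\<times> integer_mod_group 3) = vertices KO1"
      unfolding vertices vertices_12
      by (simp add: DirProd_def carrier_Z2 carrier_Z3 Sigma_def at_0) blast
    show "p 0 \<in> vertices KO1" if "is_automorphism KO1 p" for p
      using automorphism_in_vertices[OF that, of 0] by (simp add: vertices)
    let ?H = "generate (sym_group_on (vertices KO1)) {\<alpha>\<^sub>1, \<alpha>\<^sub>2, \<alpha>\<^sub>3}"
    have "\<alpha>\<^sub>1 \<in> ?H" "\<alpha>\<^sub>2 \<in> ?H" "\<alpha>\<^sub>3 \<in> ?H"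
      by (auto intro: generate.incl)
    then show "?\<phi> x \<in> ?H"
      if "x \<in> carrier (integer_mod_group 2 \<times>\<times> integer_mod_group 2 \<times>\<times> integer_mod_group 3)" for x
      using that by (auto simp: DirProd_def carrier_integer_mod_group mult_Aut int_pow_Aut
          intro!: generate_sym_compose generate_sym_funpow)
  qed (use automorphisms_KO1 in
      \<open>simp_all add: vertices DirProd_group carrier_Z2 carrier_Z3\<close>)
qed

lemma Aut_KO2:
  "carrier (Aut KO2) = generate (sym_group_on {0..11}) {\<beta>\<^sub>1, \<beta>\<^sub>2, \<beta>\<^sub>3} \<and>
    Aut KO2 \<cong> dihedral_group 6"
proof -
  interpret vertex_rigid KO2 0 by (rule vertex_rigid_0) simp
  let ?G = "Aut KO2"
  let ?r = "\<beta>\<^sub>1 \<otimes>\<^bsub>?G\<^esub> \<beta>\<^sub>2"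
  note at_0 = pow_Aut int_pow_Aut mult_Aut one_Aut funpow_numeral \<beta>\<^sub>1_def \<beta>\<^sub>2_def \<beta>\<^sub>3_def perm_simps
  have \<beta>: "\<beta>\<^sub>1 \<in> carrier ?G" "\<beta>\<^sub>2 \<in> carrier ?G" "\<beta>\<^sub>3 \<in> carrier ?G"
    using automorphisms_KO2 by auto
  note closed = m_closed nat_pow_closed one_closed \<beta>
  \<comment> \<open>\<open>\<beta>\<^sub>1\<close> and \<open>\<beta>\<^sub>2\<close> commute and have orders 2 and 3, so their product is a rotation of order 6.\<close>
  have relations: "?r [^]\<^bsub>?G\<^esub> (6::nat) = \<one>\<^bsub>?G\<^esub>" "\<beta>\<^sub>3 \<otimes>\<^bsub>?G\<^esub> \<beta>\<^sub>3 = \<one>\<^bsub>?G\<^esub>"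
    "(\<beta>\<^sub>3 \<otimes>\<^bsub>?G\<^esub> ?r) \<otimes>\<^bsub>?G\<^esub> (\<beta>\<^sub>3 \<otimes>\<^bsub>?G\<^esub> ?r) = \<one>\<^bsub>?G\<^esub>"
    by (rule automorphism_eqI, (intro closed)+, simp add: at_0)+
  let ?\<phi> = "\<lambda>(a :: int, s). ?r [^]\<^bsub>?G\<^esub> a \<otimes>\<^bsub>?G\<^esub> (if s then \<beta>\<^sub>3 else \<one>\<^bsub>?G\<^esub>)"
  have hom: "?\<phi> \<in> hom (dihedral_group 6) ?G"
    using \<beta> relations by (intro hom_dihedral_group m_closed)
  show ?thesis
    unfolding vertices(2)[symmetric]
  proof (rule regular_action[OF hom])
    show "(\<lambda>x. ?\<phi> x 0) ` carrier (dihedral_group 6) = vertices KO2"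
      unfolding vertices vertices_12
      by (simp add: carrier_D6 Sigma_def at_0) blast
    show "p 0 \<in> vertices KO2" if "is_automorphism KO2 p" for p
      using automorphism_in_vertices[OF that, of 0] by (simp add: vertices)
    let ?H = "generate (sym_group_on (vertices KO2)) {\<beta>\<^sub>1, \<beta>\<^sub>2, \<beta>\<^sub>3}"
    have "\<beta>\<^sub>1 \<in> ?H" "\<beta>\<^sub>2 \<in> ?H" "\<beta>\<^sub>3 \<in> ?H"
      by (auto intro: generate.incl)
    then show "?\<phi> x \<in> ?H"
      if "x \<in> carrier (dihedral_group 6)" for x
      using that by (auto simp: dihedral_group_def mult_Aut one_Aut int_pow_Aut
          intro!: generate_sym_compose generate_sym_funpow generate_sym_id)
  qed (use automorphisms_KO2 in
      \<open>simp_all add: vertices group_dihedral_group carrier_D6 card_cartesian_product\<close>)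
qed

lemma Aut_KNO:
  "carrier (Aut KNO) = generate (sym_group_on {0..11}) {\<gamma>\<^sub>1, \<gamma>\<^sub>2} \<and>
    Aut KNO \<cong> integer_mod_group 2 \<times>\<times> integer_mod_group 2"
proof -
  interpret vertex_rigid KNO 0 by (rule vertex_rigid_0) simp
  let ?G = "Aut KNO"
  note at_0 = pow_Aut int_pow_Aut mult_Aut one_Aut funpow_numeral \<gamma>\<^sub>1_def \<gamma>\<^sub>2_def perm_simps
  have \<gamma>: "\<gamma>\<^sub>1 \<in> carrier ?G" "\<gamma>\<^sub>2 \<in> carrier ?G"
    using automorphisms_KNO by auto
  note closed = m_closed nat_pow_closed one_closed \<gamma>
  have "\<gamma>\<^sub>1 [^]\<^bsub>?G\<^esub> (2::nat) = \<one>\<^bsub>?G\<^esub>" "\<gamma>\<^sub>2 [^]\<^bsub>?G\<^esub> (2::nat) = \<one>\<^bsub>?G\<^esub>"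
    by (rule automorphism_eqI, (intro closed)+, simp add: at_0)+
  note powers = this[THEN hom_integer_mod_group[rotated]]
  have comm: "\<gamma>\<^sub>1 \<otimes>\<^bsub>?G\<^esub> \<gamma>\<^sub>2 = \<gamma>\<^sub>2 \<otimes>\<^bsub>?G\<^esub> \<gamma>\<^sub>1"
    by (rule automorphism_eqI, (intro closed)+, simp add: at_0)
  let ?\<phi> = "\<lambda>(a :: int, b :: int). \<gamma>\<^sub>1 [^]\<^bsub>?G\<^esub> a \<otimes>\<^bsub>?G\<^esub> \<gamma>\<^sub>2 [^]\<^bsub>?G\<^esub> b"
  have hom: "?\<phi> \<in> hom (integer_mod_group 2 \<times>\<times> integer_mod_group 2) ?G"
    by (intro hom_DirProd_commuting powers int_pow_commute comm \<gamma>)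
  show ?thesis
    unfolding vertices(3)[symmetric]
  proof (rule regular_action[OF hom])
    show "(\<lambda>x. ?\<phi> x 0) ` carrier (integer_mod_group 2 \<times>\<times> integer_mod_group 2) = {0, 4, 7, 9}"
      by (simp add: DirProd_def carrier_Z2 Sigma_def at_0) blast
    let ?H = "generate (sym_group_on (vertices KNO)) {\<gamma>\<^sub>1, \<gamma>\<^sub>2}"
    have "\<gamma>\<^sub>1 \<in> ?H" "\<gamma>\<^sub>2 \<in> ?H"
      by (auto intro: generate.incl)
    then show "?\<phi> x \<in> ?H"
      if "x \<in> carrier (integer_mod_group 2 \<times>\<times> integer_mod_group 2)" for x
      using that by (auto simp: DirProd_def carrier_integer_mod_group mult_Aut int_pow_Aut
          intro!: generate_sym_compose generate_sym_funpow)
  qed (use image_0_KNO automorphisms_KNO in \<open>simp_all add: DirProd_group carrier_Z2\<close>)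
qed

theorem lemma2:
  shows
    "carrier (Aut KO1) = generate (sym_group_on {0..11}) {\<alpha>\<^sub>1, \<alpha>\<^sub>2, \<alpha>\<^sub>3} \<and>
     Aut KO1 \<cong> integer_mod_group 2 \<times>\<times> integer_mod_group 2 \<times>\<times> integer_mod_group 3 \<and>
     carrier (Aut KO2) = generate (sym_group_on {0..11}) {\<beta>\<^sub>1, \<beta>\<^sub>2, \<beta>\<^sub>3} \<and>
     Aut KO2 \<cong> dihedral_group 6 \<and>
     carrier (Aut KNO) = generate (sym_group_on {0..11}) {\<gamma>\<^sub>1, \<gamma>\<^sub>2} \<and>
     Aut KNO \<cong> integer_mod_group 2 \<times>\<times> integer_mod_group 2"
  using Aut_KO1 Aut_KO2 Aut_KNO by blast

end
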